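(* Let $Y\sim\Gamma(1,1)$. For every integer $n\ge 0$ and every real $x$, $$D_{n}^{Y}(x)=n!\sum_{l=0}^{n}\frac{(-1)^{l}}{l!}D_{l}(1-x).$$
   Context: $Y\sim\Gamma(\alpha,\beta)$ (with $\alpha,\beta>0$) means that $Y$ is the gamma random variable with density $f(y)=\frac{\beta}{\Gamma(\alpha)}e^{-\beta y}(\beta y)^{\alpha-1}$ for $y\ge 0$ and $f(y)=0$ for $y<0$; thus $\Gamma(1,1)$ has density $e^{-y}$ on $y\ge 0$. The probabilistic derangement polynomials $D_n^Y(x)$ associated with $Y$ are defined by the generating function (for $t$ near $0$) $$\frac{e^{xt}}{1-t}E\big[e^{-tY}\big]=\sum_{n=0}^{\infty}D_{n}^{Y}(x)\frac{t^{n}}{n!},$$ and the (ordinary) derangement polynomials $D_n(x)$ are defined by $$\frac{e^{xt}}{1-t}e^{-t}=\sum_{n=0}^{\infty}D_{n}(x)\frac{t^{n}}{n!}.$$ *)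

theory Defs
  imports "HOL-Probability.Probability"
begin

text \<open>At \<open>y = 0\<close> this differs from the usual convention when \<open>\<alpha> = 1\<close>, because
  \<open>0 powr 0 = 0\<close>; a single point is Lebesgue-null, so the law is not affected.\<close>

definition gamma_density :: "real \<Rightarrow> real \<Rightarrow> real \<Rightarrow> real" where
  "gamma_density \<alpha> \<beta> y =
     (if y < 0 then 0 else \<beta> / Gamma \<alpha> * exp (- \<beta> * y) * (\<beta> * y) powr (\<alpha> - 1))"

definition gamma_distributed :: "'a measure \<Rightarrow> ('a \<Rightarrow> real) \<Rightarrow> real \<Rightarrow> real \<Rightarrow> bool" where
  "gamma_distributed M Y \<alpha> \<beta> \<longleftrightarrow>
     0 < \<alpha> \<and> 0 < \<beta> \<and> distributed M lborel Y (\<lambda>y. ennreal (gamma_density \<alpha> \<beta> y))"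

text \<open>The sequence \<open>a\<close> with \<open>f t = (\<Sum>n. a n * t ^ n / fact n)\<close> for all \<open>t\<close> near \<open>0\<close>;
  unspecified if \<open>f\<close> has no such expansion.\<close>

definition egf_coeff :: "(real \<Rightarrow> real) \<Rightarrow> nat \<Rightarrow> real" where
  "egf_coeff f = (THE a. f has_fps_expansion Abs_fps (\<lambda>n. a n / fact n))"

lemma egf_coeff_eqI:
  assumes "f has_fps_expansion Abs_fps (\<lambda>n. a n / fact n)"
  shows "egf_coeff f = a"
  unfolding egf_coeff_def
proof (rule the_equality)
  fix b assume b: "f has_fps_expansion Abs_fps (\<lambda>n. b n / fact n)"
  define H where "H = Abs_fps (\<lambda>n. a n / fact n) - Abs_fps (\<lambda>n. b n / fact n)"
  have H: "(\<lambda>_. 0) has_fps_expansion (fps_deriv ^^ n) H" for n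
  proof (induction n)
    case 0
    show ?case
      using has_fps_expansion_diff[OF assms b] by (simp add: H_def)
  next
    case (Suc n)
    show ?case
      using has_fps_expansion_deriv[OF Suc] by simp
  qed
  show "b = a"
  proof
    fix n
    have "fps_nth ((fps_deriv ^^ n) H) 0 = 0"
      using H[of n] by (auto simp: has_fps_expansion_def eval_fps_at_0 dest: eventually_nhds_x_imp_x)
    then show "b n = a n"
      by (simp add: fps_0th_higher_deriv H_def)
  qed
qed (fact assms)

definition derangement_poly :: "nat \<Rightarrow> real \<Rightarrow> real" where
  "derangement_poly n x = egf_coeff (\<lambda>t. exp (x * t) / (1 - t) * exp (- t)) n"

definition prob_derangement_poly :: "'a measure \<Rightarrow> ('a \<Rightarrow> real) \<Rightarrow> nat \<Rightarrow> real \<Rightarrow> real" where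
  "prob_derangement_poly M Y n x =
     egf_coeff (\<lambda>t. exp (x * t) / (1 - t) *
       prob_space.expectation M (\<lambda>\<omega>. exp (- t * Y \<omega>))) n"

end

theory Submission
  imports Defs
begin

text \<open>
  The Laplace transform of the exponential law is \<open>1 / (1 + t)\<close> for \<open>t > -1\<close>, so the generating
  function of the probabilistic polynomials is \<open>exp (x t) / (1 + t) \<sqdot> 1 / (1 - t)\<close>. In the ordinary
  generating function at \<open>1 - x\<close> the factor \<open>exp (- t)\<close> cancels against \<open>exp t\<close>, which leaves
  \<open>exp (- x t) / (1 - t)\<close>; replacing \<open>t\<close> by \<open>- t\<close> gives exactly the factor \<open>exp (x t) / (1 + t)\<close>
  (\<open>fps_exp_div_one_plus_X_nth\<close>). The remaining factor \<open>1 / (1 - t)\<close> is the geometric series,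
  multiplication by which turns coefficients into partial sums. These are the partial sums on the
  right-hand side, the signs \<open>(- 1) ^ l\<close> coming from the substitution.
\<close>

lemma egf_coeff_eq_fps_nth:
  assumes "f has_fps_expansion F"
  shows "egf_coeff f n = fact n * fps_nth F n"
proof -
  have "Abs_fps (\<lambda>n. fact n * fps_nth F n / fact n) = F"
    by (simp add: fps_eq_iff)
  then have "egf_coeff f = (\<lambda>n. fact n * fps_nth F n)"
    using assms by (intro egf_coeff_eqI) simp
  then show ?thesis by simp
qed

lemma fps_mult_inverse_one_minus_X_nth:
  fixes F :: "'a::field fps"
  shows "fps_nth (F * inverse (1 - fps_X)) n = (\<Sum>l=0..n. fps_nth F l)"
proof -
  have "inverse (1 - fps_X) = (Abs_fps (\<lambda>_. 1) :: 'a fps)"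
    by (metis fps_inverse_gp' fps_inverse_idempotent fps_nth_Abs_fps one_neq_zero)
  then show ?thesis
    by (simp add: fps_mult_nth)
qed

text \<open>The substitution \<open>t \<mapsto> - t\<close>, read off on coefficients.\<close>

lemma fps_exp_div_one_plus_X_nth:
  fixes x :: "'a::field_char_0"
  shows "fps_nth (fps_exp x * inverse (1 + fps_X)) l
    = (- 1) ^ l * fps_nth (fps_exp (- x) * inverse (1 - fps_X)) l"
proof -
  have "fps_nth (fps_exp x * inverse (1 + fps_X)) l
      = (\<Sum>i=0..l. x ^ i / fact i * (- 1) ^ (l - i))"
    by (simp add: fps_inverse_fps_X_plus1 fps_mult_nth)
  also have "\<dots> = (\<Sum>i=0..l. (- 1) ^ l * ((- x) ^ i / fact i))"
  proof (intro sum.cong refl)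
    fix i assume "i \<in> {0..l}"
    then obtain j where j: "l = i + j"
      using le_Suc_ex by auto
    have "(- x) ^ i = (- 1) ^ i * x ^ i"
      by (rule power_minus)
    then show "x ^ i / fact i * (- 1) ^ (l - i) = (- 1) ^ l * ((- x) ^ i / fact i)"
      by (simp add: j power_add flip: power_mult_distrib)
  qed
  also have "\<dots> = (- 1) ^ l * fps_nth (fps_exp (- x) * inverse (1 - fps_X)) l"
    by (simp add: fps_mult_inverse_one_minus_X_nth sum_distrib_left)
  finally show ?thesis .
qed

lemma derangement_poly_eq_fps_nth:
  "derangement_poly n x = fact n * fps_nth (fps_exp (x - 1) * inverse (1 - fps_X)) n"
proof -
  have "(\<lambda>t::real. exp ((x - 1) * t) * inverse (1 - t))
      has_fps_expansion fps_exp (x - 1) * inverse (1 - fps_X)"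
    by (intro fps_expansion_intros) auto
  also have "(\<lambda>t::real. exp ((x - 1) * t) * inverse (1 - t))
      = (\<lambda>t. exp (x * t) / (1 - t) * exp (- t))"
    by (simp add: fun_eq_iff field_simps flip: exp_add)
  finally show ?thesis
    unfolding derangement_poly_def by (rule egf_coeff_eq_fps_nth)
qed

text \<open>
  Up to the factor \<open>1 / (1 + t)\<close>, the density of \<open>\<Gamma>(1,1)\<close> times \<open>exp (- t y)\<close> is again an
  exponential density, now of rate \<open>1 + t\<close>, and so has total mass one.
\<close>

lemma gamma_1_1_laplace_transform:
  assumes "prob_space M" and Y: "gamma_distributed M Y 1 1" and t: "t > - 1"
  shows "prob_space.expectation M (\<lambda>\<omega>. exp (- t * Y \<omega>)) = 1 / (1 + t)"
proof -
  interpret prob_space M by fact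
  have D: "distributed M lborel Y (\<lambda>y. ennreal (gamma_density 1 1 y))"
    using Y by (simp add: gamma_distributed_def)
  have nonneg: "gamma_density 1 1 y \<ge> 0" for y
    by (simp add: gamma_density_def)
  have "expectation (\<lambda>\<omega>. exp (- t * Y \<omega>))
      = (\<integral>y. gamma_density 1 1 y * exp (- t * y) \<partial>lborel)"
    by (rule distributed_integral[OF D, symmetric]) (auto simp: nonneg)
  also have "\<dots> = (\<integral>y. exponential_density (1 + t) y / (1 + t) \<partial>lborel)"
  proof (rule integral_cong_AE)
    \<comment> \<open>At \<open>y = 0\<close> the convention \<open>0 powr 0 = 0\<close> makes the two integrands differ.\<close>
    have "AE y in lborel. (y::real) \<noteq> 0"
      by (rule AE_lborel_singleton)
    then show "AE y in lborel. gamma_density 1 1 y * exp (- t * y)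
        = exponential_density (1 + t) y / (1 + t)"
    proof eventually_elim
      case (elim y)
      then show ?case
        using t by (auto simp: gamma_density_def exponential_density_def field_simps
            simp flip: exp_add)
    qed
  qed (auto simp: gamma_density_def[abs_def])
  also have "\<dots> = 1 / (1 + t)"
  proof -
    interpret E: prob_space "density lborel (exponential_density (1 + t))"
      using t by (intro prob_space_exponential_density) simp
    have "(\<integral>y. exponential_density (1 + t) y \<partial>lborel) = 1"
      using E.prob_space t
      using integral_density[of "\<lambda>_. 1::real" lborel "exponential_density (1 + t)"]
      by (simp add: exponential_density_nonneg)
    then show ?thesis by simp
  qed
  finally show ?thesis .
qed

lemma prob_derangement_poly_gamma_1_1_eq_fps_nth:
  assumes "prob_space M" and "gamma_distributed M Y 1 1"
  shows "prob_derangement_poly M Y n x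
    = fact n * fps_nth (fps_exp x * inverse (1 + fps_X) * inverse (1 - fps_X)) n"
proof -
  let ?g = "\<lambda>t. exp (x * t) / (1 - t) * prob_space.expectation M (\<lambda>\<omega>. exp (- t * Y \<omega>))"
  have "(\<lambda>t::real. exp (x * t) * inverse (1 + t) * inverse (1 - t))
      has_fps_expansion fps_exp x * inverse (1 + fps_X) * inverse (1 - fps_X)"
    by (intro fps_expansion_intros) auto
  moreover have "\<forall>\<^sub>F t in nhds 0. exp (x * t) * inverse (1 + t) * inverse (1 - t) = ?g t"
  proof -
    have "\<forall>\<^sub>F t in nhds (0::real). t \<in> {- 1<..}"
      by (intro eventually_nhds_in_open) auto
    then show ?thesis
      by eventually_elim
        (simp only: greaterThan_iff gamma_1_1_laplace_transform[OF assms] divide_inverse mult_ac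
          mult_1_right)
  qed
  ultimately have "?g has_fps_expansion fps_exp x * inverse (1 + fps_X) * inverse (1 - fps_X)"
    unfolding has_fps_expansion_def by (auto elim: eventually_elim2)
  then show ?thesis
    unfolding prob_derangement_poly_def by (rule egf_coeff_eq_fps_nth)
qed

theorem theorem2p12:
  fixes M :: "'a measure" and Y :: "'a \<Rightarrow> real" and n :: nat and x :: real
  assumes "prob_space M"
    and "gamma_distributed M Y 1 1"
  shows "prob_derangement_poly M Y n x =
    fact n * (\<Sum>l=0..n. (- 1) ^ l / fact l * derangement_poly l (1 - x))"
proof -
  have "(- 1) ^ l / fact l * derangement_poly l (1 - x)
      = fps_nth (fps_exp x * inverse (1 + fps_X)) l" for l
    by (simp add: derangement_poly_eq_fps_nth fps_exp_div_one_plus_X_nth)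
  then show ?thesis
    by (simp only: prob_derangement_poly_gamma_1_1_eq_fps_nth[OF assms]
        fps_mult_inverse_one_minus_X_nth)
qed

end
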